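(* Let $R$ be a commutative ring with identity and let $\mathbb{F}_1$, $\mathbb{F}_2$ be fields. Then: (a) If $R \cong \mathbb{F}_1 \times \mathbb{F}_2$, then $Mdim(\Gamma_E(R)) = diam(\Gamma_E(R)) = 1$. (b) $Mdim(\Gamma_E(R)) = 0$ if and only if $diam(\Gamma_E(R)) = 0$. (c) If $Z(R)^2 = 0$ and $|Z(R)| \geq 2$, then $Mdim(\Gamma_E(R)) = 0$. (d) If $R \not\cong \mathbb{Z}_2 \times \mathbb{Z}_2$, then $Mdim(\Gamma_E(R)) = 0$ if and only if $diam(\Gamma(R)) \in \{0,1\}$.
   Context: For a commutative ring $R$ with identity $1\neq 0$, $Z(R)$ denotes its set of zero-divisors (including $0$), $Z^*(R)=Z(R)\setminus\{0\}$, and $Z(R)^2=0$ means $xy=0$ for all $x,y\in Z(R)$. The zero-divisor graph $\Gamma(R)$ is the simple graph with vertex set $Z^*(R)$ in which distinct $x,y$ are adjacent iff $xy=0$. For $x\in R$ let $[x]=\{y\in R : \mathrm{ann}(x)=\mathrm{ann}(y)\}$. The compressed zero-divisor graph $\Gamma_E(R)$ is the simple graph whose vertices are the classes $[x]$ with $x\in Z(R)\setminus\{0\}$, distinct classes $[x],[y]$ being adjacent iff $xy=0$. $diam(G)$ is the maximum distance between two vertices of $G$ (equal to $0$ for a single-vertex graph). For a connected graph $G$, a vertex $v$ and $W\subseteq V(G)$, the multiset representation of $v$ with respect to $W$ is the multiset $\{d(v,w): w\in W\}$ of distances (with multiplicities). $W$ is an m-resolving set if distinct vertices have distinct multiset representations.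 $Mdim(G)$ is the minimum cardinality of an m-resolving set, with $Mdim(G)=\infty$ if none exists; by convention $Mdim$ of a single-vertex graph is $0$. *)

theory Defs
  imports
    "HOL-Algebra.Chinese_Remainder"
    "HOL-Number_Theory.Residues"
    "HOL-Library.Extended_Nat"
    "HOL-Library.Multiset"
begin

(* A simple graph is a vertex set together with a symmetric irreflexive edge relation on it. *)
type_synonym 'v sgraph = "'v set \<times> 'v rel"

abbreviation verts :: "'v sgraph \<Rightarrow> 'v set" where
  "verts G \<equiv> fst G"

abbreviation edges :: "'v sgraph \<Rightarrow> 'v rel" where
  "edges G \<equiv> snd G"

(* edges G ^^ n relates the endpoints of the walks of length n;
   the infimum is infinity if no walk exists. *)
definition gdist :: "'v sgraph \<Rightarrow> 'v \<Rightarrow> 'v \<Rightarrow> enat" where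
  "gdist G u v = (INF n \<in> {n. (u, v) \<in> edges G ^^ n}. enat n)"

(* The graph without vertices has diameter 0, since Sup {} = 0 in enat. *)
definition diam :: "'v sgraph \<Rightarrow> enat" where
  "diam G = (SUP (u, v) \<in> verts G \<times> verts G. gdist G u v)"

definition mrep :: "'v sgraph \<Rightarrow> 'v set \<Rightarrow> 'v \<Rightarrow> enat multiset" where
  "mrep G W v = image_mset (gdist G v) (mset_set W)"

(* Multisets are finite, so W ranges over finite sets. An infinite m-resolving set has infinite
   cardinality and would not change the value of Mdim in enat. *)
definition m_resolving :: "'v sgraph \<Rightarrow> 'v set \<Rightarrow> bool" where
  "m_resolving G W \<longleftrightarrow> W \<subseteq> verts G \<and> finite W \<and> inj_on (mrep G W) (verts G)"

(* Infinity if there is no m-resolving set, since Inf {} = \<infinity> in enat. *)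
definition Mdim :: "'v sgraph \<Rightarrow> enat" where
  "Mdim G = (INF W \<in> {W. m_resolving G W}. enat (card W))"

(* The convention for graphs with a single vertex; it also covers the graph without vertices. *)
lemma Mdim_trivial:
  assumes "verts G \<subseteq> {v}"
  shows "Mdim G = 0"
proof -
  have "m_resolving G {}"
    using assms by (auto simp: m_resolving_def inj_on_def)
  then have "Mdim G \<le> enat (card ({} :: 'a set))"
    unfolding Mdim_def by (intro INF_lower) simp
  then show ?thesis
    by (simp add: enat_0)
qed

definition zero_divisors :: "('a, 'm) ring_scheme \<Rightarrow> 'a set" where
  "zero_divisors R =
     {x \<in> carrier R. \<exists>y \<in> carrier R. y \<noteq> \<zero>\<^bsub>R\<^esub> \<and> x \<otimes>\<^bsub>R\<^esub> y = \<zero>\<^bsub>R\<^esub>}"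

definition nz_zero_divisors :: "('a, 'm) ring_scheme \<Rightarrow> 'a set" where
  "nz_zero_divisors R = zero_divisors R - {\<zero>\<^bsub>R\<^esub>}"

definition ann :: "('a, 'm) ring_scheme \<Rightarrow> 'a \<Rightarrow> 'a set" where
  "ann R x = {r \<in> carrier R. r \<otimes>\<^bsub>R\<^esub> x = \<zero>\<^bsub>R\<^esub>}"

definition ann_class :: "('a, 'm) ring_scheme \<Rightarrow> 'a \<Rightarrow> 'a set" where
  "ann_class R x = {y \<in> carrier R. ann R x = ann R y}"

definition zd_graph :: "('a, 'm) ring_scheme \<Rightarrow> 'a sgraph" where
  "zd_graph R =
     (nz_zero_divisors R,
      {(x, y). x \<in> nz_zero_divisors R \<and> y \<in> nz_zero_divisors R \<and>
               x \<noteq> y \<and> x \<otimes>\<^bsub>R\<^esub> y = \<zero>\<^bsub>R\<^esub>})"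

definition compressed_zd_graph :: "('a, 'm) ring_scheme \<Rightarrow> 'a set sgraph" where
  "compressed_zd_graph R =
     (ann_class R ` nz_zero_divisors R,
      {(ann_class R x, ann_class R y) | x y.
         x \<in> nz_zero_divisors R \<and> y \<in> nz_zero_divisors R \<and>
         ann_class R x \<noteq> ann_class R y \<and> x \<otimes>\<^bsub>R\<^esub> y = \<zero>\<^bsub>R\<^esub>})"

end

theory Submission
  imports Defs
begin

text \<open>
  Both \<open>Mdim G = 0\<close> and \<open>diam G = 0\<close> say that \<open>G\<close> has at most one vertex: the empty set resolves
  nothing, and distinct vertices have positive distance. In the compressed graph of a ring this means
  that all nonzero zero-divisors have the same annihilator, which is equivalent to \<open>Z(R)\<^sup>2 = 0\<close>.
  For part (d) one has to see that a complete zero-divisor graph forces \<open>Z(R)\<^sup>2 = 0\<close> unless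
  \<open>R\<close> is \<open>\<int>\<^sub>2 \<times> \<int>\<^sub>2\<close> (Anderson and Livingston). If \<open>x\<^sup>2 \<noteq> 0\<close> for some zero-divisor \<open>x\<close>, then \<open>x\<close> is
  idempotent, since otherwise \<open>x\<^sup>3 = 0\<close> and \<open>x\<close> would not annihilate the zero-divisor \<open>x + x\<^sup>2\<close>.
  Completeness then gives \<open>xR = {0, x}\<close> and \<open>(1 - x)R = {0, 1 - x}\<close>.
\<close>

section \<open>Distances, diameter and multiset dimension\<close>

text \<open>The infimum of a nonempty set of naturals in \<open>enat\<close> is attained, so a
  finite bound yields an actual walk; without walks the infimum is \<infinity>.\<close>

lemma gdist_le_iff: "gdist G u v \<le> enat n \<longleftrightarrow> (\<exists>m\<le>n. (u, v) \<in> edges G ^^ m)"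
proof
  assume le: "gdist G u v \<le> enat n"
  let ?A = "enat ` {n. (u, v) \<in> edges G ^^ n}"
  have "?A \<noteq> {}"
  proof
    assume "?A = {}"
    then have "gdist G u v = \<infinity>"
      unfolding gdist_def by (simp only: Inf_empty top_enat_def)
    with le show False
      by simp
  qed
  then have "gdist G u v \<in> ?A"
    unfolding gdist_def by (metis equals0I wellorder_InfI)
  then show "\<exists>m\<le>n. (u, v) \<in> edges G ^^ m"
    using le by auto
next
  assume "\<exists>m\<le>n. (u, v) \<in> edges G ^^ m"
  then obtain m where m: "m \<le> n" "(u, v) \<in> edges G ^^ m"
    by blast
  then have "gdist G u v \<le> enat m"
    unfolding gdist_def by (intro INF_lower) simp
  also have "\<dots> \<le> enat n"
    using m by simp
  finally show "gdist G u v \<le> enat n" .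
qed

lemma gdist_eq_0_iff: "gdist G u v = 0 \<longleftrightarrow> u = v"
  using gdist_le_iff[of G u v 0] by (simp add: zero_enat_def[symmetric])

lemma gdist_le_1_iff: "gdist G u v \<le> 1 \<longleftrightarrow> u = v \<or> (u, v) \<in> edges G"
  using gdist_le_iff[of G u v 1]
  by (auto simp: one_enat_def le_Suc_eq)

lemma diam_le_iff: "diam G \<le> c \<longleftrightarrow> (\<forall>u\<in>verts G. \<forall>v\<in>verts G. gdist G u v \<le> c)"
  by (auto simp: diam_def SUP_le_iff)

lemma diam_eq_0_iff: "diam G = 0 \<longleftrightarrow> (\<forall>u\<in>verts G. \<forall>v\<in>verts G. u = v)"
  using diam_le_iff[of G 0] by (simp add: gdist_eq_0_iff)

lemma enat_le_1_iff: "(n :: enat) \<le> 1 \<longleftrightarrow> n \<in> {0, 1}"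
  by (cases n) (auto simp: one_enat_def zero_enat_def)

text \<open>Diameter at most 1 means completeness; membership in \<open>{0, 1}\<close> is the form
  in which part (d) needs it.\<close>

lemma diam_le_1_iff:
  "diam G \<in> {0, 1} \<longleftrightarrow> (\<forall>u\<in>verts G. \<forall>v\<in>verts G. u = v \<or> (u, v) \<in> edges G)"
  unfolding enat_le_1_iff[symmetric] diam_le_iff gdist_le_1_iff ..

text \<open>As for distances, a finite infimum is attained, here by an m-resolving set of minimum
  size.\<close>

lemma Mdim_le_iff: "Mdim G \<le> enat n \<longleftrightarrow> (\<exists>W. m_resolving G W \<and> card W \<le> n)"
proof
  assume le: "Mdim G \<le> enat n"
  let ?A = "(\<lambda>W. enat (card W)) ` {W. m_resolving G W}"
  have "?A \<noteq> {}"
  proof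
    assume "?A = {}"
    then have "Mdim G = \<infinity>"
      unfolding Mdim_def by (simp only: Inf_empty top_enat_def)
    with le show False
      by simp
  qed
  then have "Mdim G \<in> ?A"
    unfolding Mdim_def by (metis equals0I wellorder_InfI)
  then show "\<exists>W. m_resolving G W \<and> card W \<le> n"
    using le by auto
next
  assume "\<exists>W. m_resolving G W \<and> card W \<le> n"
  then obtain W where W: "m_resolving G W" "card W \<le> n"
    by blast
  then have "Mdim G \<le> enat (card W)"
    unfolding Mdim_def by (intro INF_lower) simp
  also have "\<dots> \<le> enat n"
    using W by simp
  finally show "Mdim G \<le> enat n" .
qed

text \<open>An m-resolving set is finite, so cardinality 0 leaves only the empty set, which gives
  every vertex the empty multiset.\<close>

lemma Mdim_eq_0_iff: "Mdim G = 0 \<longleftrightarrow> (\<forall>u\<in>verts G. \<forall>v\<in>verts G. u = v)"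
proof -
  have "Mdim G = 0 \<longleftrightarrow> (\<exists>W. m_resolving G W \<and> card W = 0)"
    using Mdim_le_iff[of G 0] by (simp add: zero_enat_def[symmetric])
  also have "\<dots> \<longleftrightarrow> m_resolving G {}"
    by (auto simp: m_resolving_def)
  also have "\<dots> \<longleftrightarrow> (\<forall>u\<in>verts G. \<forall>v\<in>verts G. u = v)"
    by (auto simp: m_resolving_def mrep_def inj_on_def)
  finally show ?thesis .
qed

lemma single_edge_diam_Mdim:
  assumes verts: "verts G = {u, v}" and "u \<noteq> v" and "(u, v) \<in> edges G" and "(v, u) \<in> edges G"
  shows "diam G = 1" and "Mdim G = 1"
proof -
  show "diam G = 1"
    using assms diam_le_1_iff[of G] diam_eq_0_iff[of G] by auto
  \<comment> \<open>One endpoint separates the two vertices: only \<open>u\<close> has distance 0 to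
    \<open>u\<close>.\<close>
  have "m_resolving G {u}"
    using \<open>u \<noteq> v\<close> gdist_eq_0_iff[of G u u] gdist_eq_0_iff[of G v u]
    by (auto simp: m_resolving_def mrep_def inj_on_def verts)
  then have "Mdim G \<le> 1"
    unfolding one_enat_def Mdim_le_iff by (intro exI[of _ "{u}"]) simp
  moreover have "Mdim G \<noteq> 0"
    using assms Mdim_eq_0_iff[of G] by auto
  ultimately show "Mdim G = 1"
    by (simp add: enat_le_1_iff)
qed

section \<open>Annihilator classes\<close>

lemma ann_class_eq_iff:
  assumes "x \<in> carrier R"
  shows "ann_class R x = ann_class R y \<longleftrightarrow> ann R x = ann R y"
  using assms by (auto simp: ann_class_def)

lemma nz_zero_divisors_closed: "x \<in> nz_zero_divisors R \<Longrightarrow> x \<in> carrier R"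
  by (simp add: nz_zero_divisors_def zero_divisors_def)

context cring
begin

lemma nz_zero_divisorsI:
  assumes "x \<in> carrier R" "y \<in> carrier R" "x \<noteq> \<zero>" "y \<noteq> \<zero>" "x \<otimes> y = \<zero>"
  shows "x \<in> nz_zero_divisors R"
  using assms by (auto simp: nz_zero_divisors_def zero_divisors_def)

lemma nz_zero_divisorsE:
  assumes "x \<in> nz_zero_divisors R"
  obtains y where "y \<in> nz_zero_divisors R" "x \<otimes> y = \<zero>"
proof -
  obtain y where y: "x \<in> carrier R" "x \<noteq> \<zero>" "y \<in> carrier R" "y \<noteq> \<zero>" "x \<otimes> y = \<zero>"
    using assms by (auto simp: nz_zero_divisors_def zero_divisors_def)
  moreover have "y \<in> nz_zero_divisors R"
    using y by (intro nz_zero_divisorsI[of y x]) (auto simp: m_comm)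
  ultimately show thesis
    using that by blast
qed

text \<open>If all annihilators agree, then \<open>x\<close>, which kills some nonzero zero-divisor
  \<open>z\<close>, kills every other one too. If all products vanish, each of these annihilators is
  the whole of \<open>Z(R)\<close>.\<close>

lemma single_ann_class_iff:
  "(\<forall>x\<in>nz_zero_divisors R. \<forall>y\<in>nz_zero_divisors R. ann R x = ann R y) \<longleftrightarrow>
   (\<forall>x\<in>nz_zero_divisors R. \<forall>y\<in>nz_zero_divisors R. x \<otimes> y = \<zero>)"
proof (intro iffI ballI)
  fix x y
  assume eq: "\<forall>x\<in>nz_zero_divisors R. \<forall>y\<in>nz_zero_divisors R. ann R x = ann R y"
    and x: "x \<in> nz_zero_divisors R" and y: "y \<in> nz_zero_divisors R"
  obtain z where z: "z \<in> nz_zero_divisors R" "x \<otimes> z = \<zero>"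
    using x by (rule nz_zero_divisorsE)
  then have "x \<in> ann R z"
    using x by (simp add: ann_def nz_zero_divisors_closed)
  also have "ann R z = ann R y"
    using eq z y by blast
  finally show "x \<otimes> y = \<zero>"
    by (simp add: ann_def)
next
  fix x y
  assume zero: "\<forall>x\<in>nz_zero_divisors R. \<forall>y\<in>nz_zero_divisors R. x \<otimes> y = \<zero>"
    and x: "x \<in> nz_zero_divisors R" and y: "y \<in> nz_zero_divisors R"
  have "ann R w = insert \<zero> (nz_zero_divisors R)" if w: "w \<in> nz_zero_divisors R" for w
  proof -
    have "w \<in> carrier R" "w \<noteq> \<zero>"
      using w by (auto simp: nz_zero_divisors_def zero_divisors_def)
    then have "r \<in> ann R w \<longleftrightarrow> r = \<zero> \<or> r \<in> nz_zero_divisors R" for r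
      using w zero nz_zero_divisorsI[of r w] nz_zero_divisors_closed[of r R]
      by (cases "r = \<zero>") (auto simp: ann_def)
    then show ?thesis
      by blast
  qed
  then show "ann R x = ann R y"
    using x y by simp
qed

text \<open>Translates the vanishing dimension into ring-theoretic terms for parts (c) and
  (d).\<close>

lemma Mdim_compressed_eq_0_iff:
  "Mdim (compressed_zd_graph R) = 0 \<longleftrightarrow>
   (\<forall>x\<in>nz_zero_divisors R. \<forall>y\<in>nz_zero_divisors R. x \<otimes> y = \<zero>)"
  unfolding single_ann_class_iff[symmetric] Mdim_eq_0_iff
  by (simp add: compressed_zd_graph_def ann_class_eq_iff nz_zero_divisors_closed)

section \<open>Complete zero-divisor graphs\<close>

text \<open>The map sends \<open>r\<close> to its components in the decomposition of \<open>R\<close> by the idempotent \<open>e\<close>.\<close>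

lemma iso_two_element_fields:
  assumes e: "e \<in> carrier R" and idem: "e \<otimes> e = e" and "e \<noteq> \<zero>" and "\<one> \<ominus> e \<noteq> \<zero>"
    and comp1: "\<And>r. r \<in> carrier R \<Longrightarrow> e \<otimes> r \<in> {\<zero>, e}"
    and comp2: "\<And>r. r \<in> carrier R \<Longrightarrow> (\<one> \<ominus> e) \<otimes> r \<in> {\<zero>, \<one> \<ominus> e}"
  shows "R \<simeq> RDirProd (residue_ring 2) (residue_ring 2)"
proof -
  define f where "f = \<one> \<ominus> e"
  have f: "f \<in> carrier R" "f \<noteq> \<zero>"
    using assms by (auto simp: f_def)
  have idem_f: "f \<otimes> f = f"
    using e idem unfolding f_def by algebra
  have ef: "e \<otimes> f = \<zero>" "f \<otimes> e = \<zero>"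
    using e idem unfolding f_def by algebra+
  \<comment> \<open>This recovers \<open>r\<close> from its two components and later yields
    injectivity.\<close>
  have split: "r = e \<otimes> r \<oplus> f \<otimes> r" if "r \<in> carrier R" for r
    using e that unfolding f_def by algebra
  \<comment> \<open>When multiplication by \<open>i\<close> takes only the values 0 and
    \<open>i\<close>, \<open>c i\<close> reads that value as a residue modulo 2. Keeping
    \<open>i\<close> general serves both \<open>e\<close> and \<open>f\<close>.\<close>
  define c :: "'a \<Rightarrow> 'a \<Rightarrow> int" where "c i r = (if i \<otimes> r = \<zero> then 0 else 1)" for i r
  have c_hom: "c i (r \<otimes> s) = c i r * c i s mod 2" "c i (r \<oplus> s) = (c i r + c i s) mod 2"
    if i: "i \<in> carrier R" "i \<otimes> i = i" "i \<noteq> \<zero>"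
      and comp: "\<And>r. r \<in> carrier R \<Longrightarrow> i \<otimes> r \<in> {\<zero>, i}"
      and r: "r \<in> carrier R" and s: "s \<in> carrier R" for i r s
  proof -
    \<comment> \<open>Multiplying \<open>i\<close> by 1 + 1 shows that the component has
      characteristic 2, since \<open>i \<oplus> i = i\<close> would force \<open>i\<close> to
      vanish. This settles the case 1 + 1 of additivity.\<close>
    have "i \<oplus> i \<in> {\<zero>, i}"
      using comp[of "\<one> \<oplus> \<one>"] i by (simp add: r_distr)
    then have ii: "i \<oplus> i = \<zero>"
      using i by auto
    have "(i \<otimes> r) \<otimes> (i \<otimes> s) = (i \<otimes> i) \<otimes> (r \<otimes> s)"
      using i(1) r s by algebra
    then have "i \<otimes> (r \<otimes> s) = (i \<otimes> r) \<otimes> (i \<otimes> s)"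
      by (simp add: i(2))
    then show "c i (r \<otimes> s) = c i r * c i s mod 2"
      using comp[OF r] comp[OF s] i by (auto simp: c_def)
    have "i \<otimes> (r \<oplus> s) = i \<otimes> r \<oplus> i \<otimes> s"
      using i r s by (simp add: r_distr)
    then show "c i (r \<oplus> s) = (c i r + c i s) mod 2"
      using comp[OF r] comp[OF s] i ii by (auto simp: c_def)
  qed
  have comp2': "f \<otimes> r \<in> {\<zero>, f}" if "r \<in> carrier R" for r
    using comp2[OF that] by (simp add: f_def)
  note hom_e = c_hom[OF e idem \<open>e \<noteq> \<zero>\<close> comp1]
  note hom_f = c_hom[OF f(1) idem_f f(2) comp2']
  let ?h = "\<lambda>r. (c e r, c f r)"
  have carrier: "carrier (RDirProd (residue_ring 2) (residue_ring 2)) = {0, 1} \<times> {0, 1 :: int}"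
    by (auto simp: RDirProd_carrier residue_ring_def)
  have "?h \<in> ring_hom R (RDirProd (residue_ring 2) (residue_ring 2))"
    using hom_e hom_f e f \<open>e \<noteq> \<zero>\<close>
    by (intro ring_hom_memI)
      (simp_all add: carrier, auto simp: c_def RDirProd_def residue_ring_def DirProd_def monoid.defs)
  moreover have "bij_betw ?h (carrier R) (carrier (RDirProd (residue_ring 2) (residue_ring 2)))"
  proof (rule bij_betw_imageI)
    show "inj_on ?h (carrier R)"
    proof (rule inj_onI)
      fix r s
      assume rs: "r \<in> carrier R" "s \<in> carrier R" and eq: "?h r = ?h s"
      have "e \<otimes> r = e \<otimes> s" "f \<otimes> r = f \<otimes> s"
        using eq comp1[OF rs(1)] comp1[OF rs(2)] comp2'[OF rs(1)] comp2'[OF rs(2)]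
        by (auto simp: c_def split: if_splits)
      then show "r = s"
        using split[OF rs(1)] split[OF rs(2)] by metis
    qed
    \<comment> \<open>The elements 0, 1, \<open>e\<close> and \<open>f\<close> already reach all
      four pairs.\<close>
    have "?h \<zero> = (0, 0)" "?h \<one> = (1, 1)" "?h e = (1, 0)" "?h f = (0, 1)"
      using e f idem idem_f ef \<open>e \<noteq> \<zero>\<close> by (auto simp: c_def)
    then have "{0, 1} \<times> {0, 1} \<subseteq> ?h ` carrier R"
      using e f(1) by (auto simp: image_iff)
    moreover have "?h ` carrier R \<subseteq> {0, 1} \<times> {0, 1}"
      by (auto simp: c_def split: if_splits)
    ultimately show "?h ` carrier R = carrier (RDirProd (residue_ring 2) (residue_ring 2))"
      unfolding carrier by blast
  qed
  ultimately show ?thesis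
    by (auto simp: is_ring_iso_def ring_iso_def)
qed

lemma complete_zd_graph_cases:
  assumes complete: "\<And>x y. x \<in> nz_zero_divisors R \<Longrightarrow> y \<in> nz_zero_divisors R \<Longrightarrow> x \<noteq> y \<Longrightarrow>
      x \<otimes> y = \<zero>"
  shows "R \<simeq> RDirProd (residue_ring 2) (residue_ring 2) \<or>
    (\<forall>x\<in>nz_zero_divisors R. \<forall>y\<in>nz_zero_divisors R. x \<otimes> y = \<zero>)"
proof (cases "\<exists>x\<in>nz_zero_divisors R. x \<otimes> x \<noteq> \<zero>")
  case False
  then show ?thesis
    using complete by metis
next
  case True
  then obtain e where eZ: "e \<in> nz_zero_divisors R" and sq: "e \<otimes> e \<noteq> \<zero>"
    by blast
  have e: "e \<in> carrier R" "e \<noteq> \<zero>"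
    using eZ by (auto simp: nz_zero_divisors_def zero_divisors_def)
  obtain z where z: "z \<in> carrier R" "z \<noteq> \<zero>" "e \<otimes> z = \<zero>"
    using eZ by (auto simp: nz_zero_divisors_def zero_divisors_def)
  have idem: "e \<otimes> e = e"
  proof (rule ccontr)
    assume ne: "e \<otimes> e \<noteq> e"
    have "(e \<otimes> e) \<otimes> z = \<zero>"
      using e z by (simp add: m_assoc)
    then have "e \<otimes> e \<in> nz_zero_divisors R"
      using e z sq by (intro nz_zero_divisorsI[of _ z]) auto
    then have cube: "e \<otimes> (e \<otimes> e) = \<zero>"
      using complete[OF eZ] ne by metis
    \<comment> \<open>By the vanishing cube, this product is the nonzero square of \<open>e\<close>.
      Yet \<open>z\<close> also kills \<open>e \<oplus> e \<otimes> e\<close>, so completeness would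
      make the product zero.\<close>
    have prod: "e \<otimes> (e \<oplus> e \<otimes> e) = e \<otimes> e"
      using e cube by (simp add: r_distr)
    have "(e \<oplus> e \<otimes> e) \<otimes> z = \<zero>"
      using e z by (simp add: l_distr m_assoc)
    moreover have "e \<oplus> e \<otimes> e \<noteq> \<zero>"
      using prod sq e by auto
    ultimately have "e \<oplus> e \<otimes> e \<in> nz_zero_divisors R"
      using e z by (intro nz_zero_divisorsI[of _ z]) auto
    moreover have "e \<noteq> e \<oplus> e \<otimes> e"
      using e sq by simp
    ultimately have "e \<otimes> (e \<oplus> e \<otimes> e) = \<zero>"
      using complete[OF eZ] by blast
    with prod sq show False
      by simp
  qed
  \<comment> \<open>Whatever kills \<open>i\<close> kills \<open>i \<otimes> r\<close>. Were this a
    nonzero element other than \<open>i\<close>, completeness would give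
    \<open>i \<otimes> (i \<otimes> r) = \<zero>\<close>, but idempotence makes that product
    \<open>i \<otimes> r\<close> itself.\<close>
  have comp: "i \<otimes> r \<in> {\<zero>, i}"
    if i: "i \<in> nz_zero_divisors R" "i \<otimes> i = i" and r: "r \<in> carrier R" for i r
  proof (rule ccontr)
    assume not: "i \<otimes> r \<notin> {\<zero>, i}"
    obtain y where y: "y \<in> carrier R" "y \<noteq> \<zero>" "i \<otimes> y = \<zero>" and ic: "i \<in> carrier R"
      using i by (auto simp: nz_zero_divisors_def zero_divisors_def)
    have "(i \<otimes> r) \<otimes> y = r \<otimes> (i \<otimes> y)"
      using ic r y(1) by algebra
    then have "i \<otimes> r \<in> nz_zero_divisors R"
      using ic r y not by (intro nz_zero_divisorsI[of _ y]) auto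
    then have "i \<otimes> (i \<otimes> r) = \<zero>"
      using complete[OF i(1)] not by auto
    then show False
      using i ic r not by (simp add: m_assoc[symmetric])
  qed
  have f0: "\<one> \<ominus> e \<noteq> \<zero>"
  proof
    assume "\<one> \<ominus> e = \<zero>"
    then have "e = \<one>"
      using e by simp
    then show False
      using z by simp
  qed
  have "(\<one> \<ominus> e) \<otimes> e = \<zero>" and idem_f: "(\<one> \<ominus> e) \<otimes> (\<one> \<ominus> e) = \<one> \<ominus> e"
    using e(1) idem by algebra+
  then have "\<one> \<ominus> e \<in> nz_zero_divisors R"
    using e f0 by (intro nz_zero_divisorsI[of _ e]) auto
  then show ?thesis
    using iso_two_element_fields[OF e(1) idem e(2) f0 comp[OF eZ idem] comp[OF _ idem_f]] by blast
qed

section \<open>Products of two fields\<close>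

text \<open>A nonzero zero-divisor of a product of two fields has exactly one vanishing coordinate,
  and which one it is determines its annihilator. So the compressed graph is a single edge.\<close>

lemma compressed_zd_graph_prod_fields:
  assumes F1: "field F1" and F2: "field F2" and iso: "R \<simeq> RDirProd F1 F2"
  shows "diam (compressed_zd_graph R) = 1" and "Mdim (compressed_zd_graph R) = 1"
proof -
  interpret F1: field F1 by fact
  interpret F2: field F2 by fact
  interpret P: ring "RDirProd F1 F2"
    by (rule RDirProd_ring) unfold_locales
  obtain h where hom: "h \<in> ring_hom R (RDirProd F1 F2)"
    and bij: "bij_betw h (carrier R) (carrier (RDirProd F1 F2))"
    using iso by (auto simp: is_ring_iso_def ring_iso_def)
  interpret h: ring_hom_ring R "RDirProd F1 F2" h
    by (rule ring_hom_ringI2[OF ring_axioms P.ring_axioms hom])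
  define p q where "p r = fst (h r)" and "q r = snd (h r)" for r
  have closed: "p r \<in> carrier F1" "q r \<in> carrier F2" if "r \<in> carrier R" for r
    using h.hom_closed[OF that] by (auto simp: p_def q_def RDirProd_def DirProd_def monoid.defs)
  have mult: "p (r \<otimes> s) = p r \<otimes>\<^bsub>F1\<^esub> p s" "q (r \<otimes> s) = q r \<otimes>\<^bsub>F2\<^esub> q s"
    if "r \<in> carrier R" "s \<in> carrier R" for r s
    using h.hom_mult[OF that]
    by (auto simp: p_def q_def RDirProd_def DirProd_def monoid.defs split: prod.splits)
  have zero: "p \<zero> = \<zero>\<^bsub>F1\<^esub>" "q \<zero> = \<zero>\<^bsub>F2\<^esub>"
    using h.hom_zero by (simp_all add: p_def q_def RDirProd_def monoid.defs)
  have eq: "r = s \<longleftrightarrow> p r = p s \<and> q r = q s" if "r \<in> carrier R" "s \<in> carrier R" for r s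
    using bij that by (auto simp: bij_betw_def inj_on_def p_def q_def prod_eq_iff)
  \<comment> \<open>Fields have no proper zero-divisors, so a product vanishes coordinatewise; this
    decides all annihilators below.\<close>
  have prod0: "r \<otimes> s = \<zero> \<longleftrightarrow> (p r = \<zero>\<^bsub>F1\<^esub> \<or> p s = \<zero>\<^bsub>F1\<^esub>) \<and> (q r = \<zero>\<^bsub>F2\<^esub> \<or> q s = \<zero>\<^bsub>F2\<^esub>)"
    if "r \<in> carrier R" "s \<in> carrier R" for r s
    using that eq[of "r \<otimes> s" \<zero>]
    by (simp add: mult zero F1.integral_iff F2.integral_iff closed)
  have surj: "\<exists>r\<in>carrier R. p r = a \<and> q r = b" if "a \<in> carrier F1" "b \<in> carrier F2" for a b
  proof -
    have "(a, b) \<in> h ` carrier R"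
      using bij that by (auto simp: bij_betw_def RDirProd_def DirProd_def monoid.defs)
    then obtain r where "r \<in> carrier R" "h r = (a, b)"
      by auto
    then show ?thesis
      by (intro bexI[of _ r]) (simp_all add: p_def q_def)
  qed
  obtain u where u: "u \<in> carrier R" "p u = \<one>\<^bsub>F1\<^esub>" "q u = \<zero>\<^bsub>F2\<^esub>"
    using surj[of "\<one>\<^bsub>F1\<^esub>" "\<zero>\<^bsub>F2\<^esub>"] by auto
  obtain v where v: "v \<in> carrier R" "p v = \<zero>\<^bsub>F1\<^esub>" "q v = \<one>\<^bsub>F2\<^esub>"
    using surj[of "\<zero>\<^bsub>F1\<^esub>" "\<one>\<^bsub>F2\<^esub>"] by auto
  have uv: "u \<otimes> v = \<zero>" "v \<otimes> u = \<zero>" "u \<noteq> \<zero>" "v \<noteq> \<zero>"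
    using u v zero prod0 by auto
  then have uvZ: "u \<in> nz_zero_divisors R" "v \<in> nz_zero_divisors R"
    using u v nz_zero_divisorsI by blast+
  \<comment> \<open>This separates the classes: \<open>u\<close> annihilates \<open>v\<close> but
    not itself.\<close>
  have "u \<otimes> u \<noteq> \<zero>"
    using u prod0[of u u] by simp
  then have ne: "ann_class R u \<noteq> ann_class R v"
    using u v uv by (auto simp: ann_class_eq_iff ann_def)
  have "ann R x = ann R u \<or> ann R x = ann R v" if x: "x \<in> nz_zero_divisors R" for x
  proof -
    obtain y where y: "y \<in> nz_zero_divisors R" "x \<otimes> y = \<zero>"
      using x by (rule nz_zero_divisorsE)
    have carr: "x \<in> carrier R" "y \<in> carrier R" and "x \<noteq> \<zero>" "y \<noteq> \<zero>"
      using x y by (auto simp: nz_zero_divisors_def zero_divisors_def)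
    \<comment> \<open>Two nonzero coordinates of \<open>x\<close> would force \<open>y\<close> to
      vanish, and two zero coordinates would make \<open>x\<close> vanish.\<close>
    then have "p x \<noteq> \<zero>\<^bsub>F1\<^esub> \<and> q x = \<zero>\<^bsub>F2\<^esub> \<or> p x = \<zero>\<^bsub>F1\<^esub> \<and> q x \<noteq> \<zero>\<^bsub>F2\<^esub>"
      using prod0[OF carr] y eq[of x \<zero>] eq[of y \<zero>] zero by auto
    then show ?thesis
      using carr u v by (auto simp: ann_def prod0)
  qed
  then have "ann_class R x \<in> {ann_class R u, ann_class R v}" if "x \<in> nz_zero_divisors R" for x
    using that by (simp add: ann_class_eq_iff nz_zero_divisors_closed)
  then have "verts (compressed_zd_graph R) = {ann_class R u, ann_class R v}"
    using uvZ unfolding compressed_zd_graph_def fst_conv by blast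
  moreover have "(ann_class R u, ann_class R v) \<in> edges (compressed_zd_graph R)"
    "(ann_class R v, ann_class R u) \<in> edges (compressed_zd_graph R)"
    using uvZ uv ne by (auto simp: compressed_zd_graph_def)
  ultimately show "diam (compressed_zd_graph R) = 1" "Mdim (compressed_zd_graph R) = 1"
    using ne by (intro single_edge_diam_Mdim; blast)+
qed

end

theorem theorem4p2:
  fixes R :: "('a, 'm) ring_scheme"
    and F1 :: "('b, 'n) ring_scheme"
    and F2 :: "('c, 'k) ring_scheme"
  assumes "cring R" and "\<one>\<^bsub>R\<^esub> \<noteq> \<zero>\<^bsub>R\<^esub>" and "field F1" and "field F2"
  shows
    "(R \<simeq> RDirProd F1 F2 \<longrightarrow>
        Mdim (compressed_zd_graph R) = 1 \<and> diam (compressed_zd_graph R) = 1) \<and>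
     (Mdim (compressed_zd_graph R) = 0 \<longleftrightarrow> diam (compressed_zd_graph R) = 0) \<and>
     ((\<forall>x \<in> zero_divisors R. \<forall>y \<in> zero_divisors R. x \<otimes>\<^bsub>R\<^esub> y = \<zero>\<^bsub>R\<^esub>) \<and>
        (infinite (zero_divisors R) \<or> card (zero_divisors R) \<ge> 2) \<longrightarrow>
        Mdim (compressed_zd_graph R) = 0) \<and>
     (\<not> R \<simeq> RDirProd (residue_ring 2) (residue_ring 2) \<longrightarrow>
        (Mdim (compressed_zd_graph R) = 0 \<longleftrightarrow> diam (zd_graph R) \<in> {0, 1}))"
proof (intro conjI impI)
  interpret cring R by fact
  show "Mdim (compressed_zd_graph R) = 1" "diam (compressed_zd_graph R) = 1"
    if "R \<simeq> RDirProd F1 F2"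
    using compressed_zd_graph_prod_fields[OF assms(3,4) that] by simp_all
  show "Mdim (compressed_zd_graph R) = 0 \<longleftrightarrow> diam (compressed_zd_graph R) = 0"
    by (simp add: Mdim_eq_0_iff diam_eq_0_iff)
  show "Mdim (compressed_zd_graph R) = 0"
    if "(\<forall>x \<in> zero_divisors R. \<forall>y \<in> zero_divisors R. x \<otimes>\<^bsub>R\<^esub> y = \<zero>\<^bsub>R\<^esub>) \<and>
        (infinite (zero_divisors R) \<or> card (zero_divisors R) \<ge> 2)"
    using that by (auto simp: Mdim_compressed_eq_0_iff nz_zero_divisors_def)
  have diam_iff: "diam (zd_graph R) \<in> {0, 1} \<longleftrightarrow>
      (\<forall>x\<in>nz_zero_divisors R. \<forall>y\<in>nz_zero_divisors R. x \<noteq> y \<longrightarrow> x \<otimes>\<^bsub>R\<^esub> y = \<zero>\<^bsub>R\<^esub>)"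
    unfolding diam_le_1_iff by (auto simp: zd_graph_def)
  show "Mdim (compressed_zd_graph R) = 0 \<longleftrightarrow> diam (zd_graph R) \<in> {0, 1}"
    if "\<not> R \<simeq> RDirProd (residue_ring 2) (residue_ring 2)"
    \<comment> \<open>The two sides now differ only in the squares \<open>x \<otimes> x\<close>,
      which completeness forces to vanish once the exceptional ring is excluded.\<close>
    unfolding diam_iff Mdim_compressed_eq_0_iff
    using that complete_zd_graph_cases by blast
qed

end
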